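(* Let $\mathcal{P}$ be a problem given by a mapping $F_{\mathcal{P}}=(f_1,\dots,f_m):\{0,1\}^n\to\{0,1\}^m$. (1) If there is a linear data structure for $\mathcal{P}$ with query time $t_q$ and update time $t_u$, then there exists a depth-2 linear circuit $C$ computing $F_{\mathcal{P}}$ with size $s(C)\le n t_u+m t_q$. (2) If there is a depth-2 linear circuit $C$ that computes $F_{\mathcal{P}}$, then there is a linear data structure for $\mathcal{P}$ with average query time at most $s(C)/m$ and average update time at most $s(C)/n$.
   Context: **Linear data structures.** The input is an array $A\in\{0,1\}^n$ of bits; the $i$th update ($1\le i\le n$) flips the $i$th bit of $A$; the $j$th query ($1\le j\le m$) asks for $f_j(A)$. A linear data structure has a collection of cells each storing a single bit (word size $w=1$). With each update $i$ is associated a fixed set of probed cells, and with each query $j$ a fixed set of probed cells (i.e. both algorithms are non-adaptive). When processing an update, the contents of all its probed cells are flipped; on a query, the data structure returns the XOR of the bits stored in all its probed cells. Thus every cell stores a fixed linear combination over $\mathrm{GF}(2)$ of the bits of $A$ (in particular all cells are $0$ when $A=0$), and every query returns a linear combination over $\mathrm{GF}(2)$ of the stored bits. The data structure solves $\mathcal{P}$ if after any sequence of updates to $A$, for all $1\le j\le m$, answering the $j$th query returns $f_j(A)$. The query time $t_q$ (update time $t_u$) is the maximum number of cells probed by a query (update); the average query time (average update time) is the average number of cells probed over the $m$ queries (over the $n$ updates). **Depth-2 circuits.** A depth-2 circuit computing $F:\{0,1\}^n\to\{0,1\}^m$ is a directed graph with three layers of vertices: $n$ input nodes $x_1,\dots,x_n$,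 a layer of interior gates outputting Boolean values, and $m$ output gates $z_1,\dots,z_m$. Edges (wires) go from input nodes to interior gates and from interior gates to output gates; fan-in and fan-out are unbounded. The circuit is linear if every gate outputs the XOR (sum in $\mathrm{GF}(2)$) of its inputs. The size $s(C)$ is the number of wires (edges). *)

theory Defs
  imports "HOL-Analysis.Finite_Cartesian_Product" "HOL-Library.Z2"
begin

text \<open>
  Bits are elements of the two-element field \<^typ>\<open>bit\<close>, so XOR is addition and the XOR of a family
  is a sum. A vector in \<open>{0,1}\<^sup>n\<close> is a \<open>bit ^ 'n\<close> with \<open>CARD('n) = n\<close>; since types are nonempty,
  \<open>n, m \<ge> 1\<close>. Cells and interior gates are named by natural numbers.
\<close>

type_synonym ('n, 'm) problem = "bit ^ 'n \<Rightarrow> bit ^ 'm"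


subsection \<open>Linear data structures\<close>

record ('n, 'm) linear_ds =
  cells :: "nat set"
  update_probes :: "'n \<Rightarrow> nat set"
  query_probes :: "'m \<Rightarrow> nat set"

definition wf_linear_ds :: "('n, 'm) linear_ds \<Rightarrow> bool" where
  "wf_linear_ds D \<longleftrightarrow>
     finite (cells D) \<and>
     (\<forall>i. update_probes D i \<subseteq> cells D) \<and>
     (\<forall>j. query_probes D j \<subseteq> cells D)"

definition flip_bit_at :: "'n::finite \<Rightarrow> bit ^ 'n \<Rightarrow> bit ^ 'n" where
  "flip_bit_at i A = (\<chi> k. if k = i then A $ k + 1 else A $ k)"

definition process_update ::
  "('n, 'm) linear_ds \<Rightarrow> 'n \<Rightarrow> (nat \<Rightarrow> bit) \<Rightarrow> (nat \<Rightarrow> bit)" where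
  "process_update D i mem = (\<lambda>c. if c \<in> update_probes D i then mem c + 1 else mem c)"

definition answer_query ::
  "('n, 'm) linear_ds \<Rightarrow> 'm \<Rightarrow> (nat \<Rightarrow> bit) \<Rightarrow> bit" where
  "answer_query D j mem = (\<Sum>c\<in>query_probes D j. mem c)"

text \<open>
  Update sequences start from the zero array, for which all cells are 0; every other array is
  reached from there by flips.
\<close>

definition array_after :: "'n::finite list \<Rightarrow> bit ^ 'n" where
  "array_after us = fold flip_bit_at us 0"

definition memory_after :: "('n, 'm) linear_ds \<Rightarrow> 'n list \<Rightarrow> (nat \<Rightarrow> bit)" where
  "memory_after D us = fold (process_update D) us (\<lambda>c. 0)"

definition ds_solves ::
  "('n::finite, 'm::finite) linear_ds \<Rightarrow> ('n, 'm) problem \<Rightarrow> bool" where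
  "ds_solves D F \<longleftrightarrow>
     (\<forall>us j. answer_query D j (memory_after D us) = F (array_after us) $ j)"

definition update_time :: "('n::finite, 'm) linear_ds \<Rightarrow> nat" where
  "update_time D = Max (range (\<lambda>i. card (update_probes D i)))"

definition query_time :: "('n, 'm::finite) linear_ds \<Rightarrow> nat" where
  "query_time D = Max (range (\<lambda>j. card (query_probes D j)))"

definition avg_update_time :: "('n::finite, 'm) linear_ds \<Rightarrow> real" where
  "avg_update_time D = real (\<Sum>i\<in>UNIV. card (update_probes D i)) / real CARD('n)"

definition avg_query_time :: "('n, 'm::finite) linear_ds \<Rightarrow> real" where
  "avg_query_time D = real (\<Sum>j\<in>UNIV. card (query_probes D j)) / real CARD('m)"


subsection \<open>Depth-2 circuits\<close>

text \<open>
  The three layers are the types \<open>'n\<close> (inputs) and \<open>'m\<close> (output gates) and the set of interior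
  gates. A gate function takes a value for every vertex of the preceding layer; well-formedness
  requires it to depend only on the vertices wired to the gate.
\<close>

record ('n, 'm) depth2_circuit =
  interior :: "nat set"
  in_wires :: "('n \<times> nat) set"
  out_wires :: "(nat \<times> 'm) set"
  interior_fun :: "nat \<Rightarrow> ('n \<Rightarrow> bit) \<Rightarrow> bit"
  output_fun :: "'m \<Rightarrow> (nat \<Rightarrow> bit) \<Rightarrow> bit"

definition wf_depth2_circuit :: "('n, 'm) depth2_circuit \<Rightarrow> bool" where
  "wf_depth2_circuit C \<longleftrightarrow>
     finite (interior C) \<and>
     in_wires C \<subseteq> UNIV \<times> interior C \<and>
     out_wires C \<subseteq> interior C \<times> UNIV \<and>
     (\<forall>g\<in>interior C. \<forall>a b. (\<forall>i. (i, g) \<in> in_wires C \<longrightarrow> a i = b i) \<longrightarrow>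
        interior_fun C g a = interior_fun C g b) \<and>
     (\<forall>j a b. (\<forall>g. (g, j) \<in> out_wires C \<longrightarrow> a g = b g) \<longrightarrow>
        output_fun C j a = output_fun C j b)"

definition linear_circuit :: "('n::finite, 'm) depth2_circuit \<Rightarrow> bool" where
  "linear_circuit C \<longleftrightarrow>
     (\<forall>g\<in>interior C. \<forall>a. interior_fun C g a = (\<Sum>i | (i, g) \<in> in_wires C. a i)) \<and>
     (\<forall>j a. output_fun C j a = (\<Sum>g | (g, j) \<in> out_wires C. a g))"

definition circuit_map ::
  "('n::finite, 'm::finite) depth2_circuit \<Rightarrow> bit ^ 'n \<Rightarrow> bit ^ 'm" where
  "circuit_map C x = (\<chi> j. output_fun C j (\<lambda>g. interior_fun C g (\<lambda>i. x $ i)))"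

definition circuit_computes ::
  "('n::finite, 'm::finite) depth2_circuit \<Rightarrow> ('n, 'm) problem \<Rightarrow> bool" where
  "circuit_computes C F \<longleftrightarrow> (\<forall>x. circuit_map C x = F x)"

definition circuit_size :: "('n, 'm) depth2_circuit \<Rightarrow> nat" where
  "circuit_size C = card (in_wires C) + card (out_wires C)"

end

theory Submission
  imports Defs
begin

text \<open>A linear data structure and a depth-2 linear circuit are the same combinatorial object:
  cells are interior gates, update probes are the wires into them, query probes are the wires out of
  them. The dynamic side reduces to a static one because a cell always holds the XOR of the array
  bits whose updates probe it (\<open>memory_after_eq\<close>), and flips starting from zero reach
  every array (\<open>surj_array_after\<close>). Hence both "solves" and "computes" say that one and
  the same double sum over GF(2) equals \<open>F\<close> (\<open>ds_solves_iff\<close>,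
  \<open>circuit_computes_iff\<close>), and the translation preserves correctness in both
  directions. The number of wires is the total number of update probes plus the total number of
  query probes. Bounding each probe count by its maximum gives (1); dropping one of the two totals
  gives (2).\<close>

lemma memory_after_eq:
  fixes D :: "('n::finite, 'm) linear_ds"
  shows "memory_after D us c = (\<Sum>i | c \<in> update_probes D i. array_after us $ i)"
proof (induction us rule: rev_induct)
  case Nil
  show ?case by (simp add: memory_after_def array_after_def)
next
  case (snoc u us)
  \<comment> \<open>The flip of bit \<open>u\<close> is written as adding an indicator at
    \<open>u\<close>, so that the sum splits: the indicator contributes 1 exactly when update
    \<open>u\<close> probes \<open>c\<close>, which is when the memory flips
    \<open>c\<close>.\<close>
  have "(\<Sum>i | c \<in> update_probes D i. array_after (us @ [u]) $ i) =
      (\<Sum>i | c \<in> update_probes D i. array_after us $ i + (if i = u then 1 else 0))"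
    by (intro sum.cong) (auto simp only: array_after_def flip_bit_at_def fold_append comp_apply
      fold_simps vec_lambda_beta add_0_right split: if_split)
  also have "\<dots> = memory_after D us c + (\<Sum>i | c \<in> update_probes D i. if i = u then 1 else 0)"
    by (simp only: sum.distrib snoc)
  also have "(\<Sum>i | c \<in> update_probes D i. if i = u then 1 else 0) =
      (if c \<in> update_probes D u then 1 else (0 :: bit))"
    by (subst sum.delta) simp_all
  also have "memory_after D us c + \<dots> = memory_after D (us @ [u]) c"
    by (simp add: memory_after_def process_update_def)
  finally show ?case ..
qed

text \<open>Flipping each position of the support once produces any given array from zero. The
  induction therefore runs over the support \<open>S\<close>.\<close>

lemma surj_array_after: "surj (array_after :: 'n::finite list \<Rightarrow> bit ^ 'n)"
proof -
  have "\<exists>us. array_after us = (\<chi> k. if k \<in> S then 1 else 0)" for S :: "'n set"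
    using finite[of S]
  proof (induction S)
    case empty
    have "array_after [] = (\<chi> k::'n. if k \<in> {} then 1 else 0)"
      by (simp add: array_after_def vec_eq_iff)
    then show ?case by blast
  next
    case (insert i S)
    then obtain us where "array_after us = (\<chi> k. if k \<in> S then 1 else 0)" by blast
    with insert.hyps have "array_after (us @ [i]) = (\<chi> k. if k \<in> insert i S then 1 else 0)"
      by (auto simp: array_after_def flip_bit_at_def vec_eq_iff)
    then show ?case by blast
  qed
  moreover have "A = (\<chi> k. if k \<in> {k. A $ k = 1} then 1 else 0)" for A :: "bit ^ 'n"
    by (simp add: vec_eq_iff)
  ultimately show ?thesis by (metis surj_def)
qed

text \<open>Removes update sequences from the notion of solving: the answer depends on the sequence
  only through the resulting array, and by surjectivity that array is arbitrary.\<close>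

lemma ds_solves_iff:
  fixes D :: "('n::finite, 'm::finite) linear_ds"
  shows "ds_solves D F \<longleftrightarrow>
    (\<forall>x j. (\<Sum>c\<in>query_probes D j. \<Sum>i | c \<in> update_probes D i. x $ i) = F x $ j)"
proof -
  have "ds_solves D F \<longleftrightarrow> (\<forall>us j. (\<Sum>c\<in>query_probes D j.
      \<Sum>i | c \<in> update_probes D i. array_after us $ i) = F (array_after us) $ j)"
    by (simp add: ds_solves_def answer_query_def memory_after_eq)
  then show ?thesis
    by (metis surj_array_after surjD)
qed

lemma circuit_computes_iff:
  fixes C :: "('n::finite, 'm::finite) depth2_circuit"
  assumes "wf_depth2_circuit C" "linear_circuit C"
  shows "circuit_computes C F \<longleftrightarrow>
    (\<forall>x j. (\<Sum>g | (g, j) \<in> out_wires C. \<Sum>i | (i, g) \<in> in_wires C. x $ i) = F x $ j)"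
proof -
  have "circuit_map C x $ j = (\<Sum>g | (g, j) \<in> out_wires C. \<Sum>i | (i, g) \<in> in_wires C. x $ i)"
    for x j
  proof -
    \<comment> \<open>\<open>linear_circuit\<close> prescribes \<open>interior_fun\<close> only on
      interior gates, so every gate that feeds an output must be known to be one.\<close>
    have "g \<in> interior C" if "(g, j) \<in> out_wires C" for g
      using assms(1) that by (auto simp: wf_depth2_circuit_def)
    with assms(2) show ?thesis
      by (simp add: circuit_map_def linear_circuit_def)
  qed
  then show ?thesis
    by (simp add: circuit_computes_def vec_eq_iff)
qed

text \<open>Double counting by fibres. Finiteness matters because \<open>card\<close> of an infinite
  set is 0: one infinite fibre would make the left side 0 while other fibres could still count on
  the right.\<close>

lemma card_wires_by_source:
  fixes W :: "('a::finite \<times> 'b) set"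
  assumes "\<And>a. finite {b. (a, b) \<in> W}"
  shows "card W = (\<Sum>a\<in>UNIV. card {b. (a, b) \<in> W})"
proof -
  have "W = (SIGMA a:UNIV. {b. (a, b) \<in> W})" by auto
  then have "card W = card (SIGMA a:UNIV. {b. (a, b) \<in> W})" by (rule arg_cong)
  then show ?thesis using assms by simp
qed

lemma card_wires_by_target:
  fixes W :: "('b \<times> 'a::finite) set"
  assumes "\<And>a. finite {b. (b, a) \<in> W}"
  shows "card W = (\<Sum>a\<in>UNIV. card {b. (b, a) \<in> W})"
  using card_wires_by_source[of "W\<inverse>"] assms by simp

definition circuit_of_ds :: "('n::finite, 'm::finite) linear_ds \<Rightarrow> ('n, 'm) depth2_circuit" where
  "circuit_of_ds D =
     \<lparr>interior = cells D,
      in_wires = {(i, c). c \<in> update_probes D i},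
      out_wires = {(c, j). c \<in> query_probes D j},
      interior_fun = (\<lambda>c a. \<Sum>i | c \<in> update_probes D i. a i),
      output_fun = (\<lambda>j a. \<Sum>c\<in>query_probes D j. a c)\<rparr>"

definition ds_of_circuit :: "('n::finite, 'm::finite) depth2_circuit \<Rightarrow> ('n, 'm) linear_ds" where
  "ds_of_circuit C =
     \<lparr>cells = interior C,
      update_probes = (\<lambda>i. {g. (i, g) \<in> in_wires C}),
      query_probes = (\<lambda>j. {g. (g, j) \<in> out_wires C})\<rparr>"

lemma linear_circuit_of_ds: "linear_circuit (circuit_of_ds D)"
  by (simp add: linear_circuit_def circuit_of_ds_def)

lemma wf_circuit_of_ds: "wf_linear_ds D \<Longrightarrow> wf_depth2_circuit (circuit_of_ds D)"
  by (auto simp: wf_linear_ds_def wf_depth2_circuit_def circuit_of_ds_def intro!: sum.cong)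

lemma circuit_of_ds_computes:
  assumes "wf_linear_ds D"
  shows "circuit_computes (circuit_of_ds D) F \<longleftrightarrow> ds_solves D F"
  unfolding circuit_computes_iff[OF wf_circuit_of_ds[OF assms] linear_circuit_of_ds] ds_solves_iff
  by (simp add: circuit_of_ds_def)

lemma wf_ds_of_circuit: "wf_depth2_circuit C \<Longrightarrow> wf_linear_ds (ds_of_circuit C)"
  by (auto simp: wf_linear_ds_def wf_depth2_circuit_def ds_of_circuit_def)

lemma ds_of_circuit_solves:
  assumes "wf_depth2_circuit C" "linear_circuit C"
  shows "ds_solves (ds_of_circuit C) F \<longleftrightarrow> circuit_computes C F"
  unfolding circuit_computes_iff[OF assms] ds_solves_iff by (simp add: ds_of_circuit_def)

lemma finite_probes:
  assumes "wf_linear_ds D"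
  shows "finite (update_probes D i)" "finite (query_probes D j)"
  using assms by (meson wf_linear_ds_def finite_subset)+

lemma circuit_size_circuit_of_ds:
  fixes D :: "('n::finite, 'm::finite) linear_ds"
  assumes "wf_linear_ds D"
  shows "circuit_size (circuit_of_ds D) =
    (\<Sum>i\<in>UNIV. card (update_probes D i)) + (\<Sum>j\<in>UNIV. card (query_probes D j))"
  using finite_probes[OF assms]
  by (simp add: circuit_size_def circuit_of_ds_def card_wires_by_source card_wires_by_target)

text \<open>Translating \<open>C\<close> to a data structure and back restores its wires, and the
  size depends on nothing else, so the count for \<open>circuit_of_ds\<close> carries over.\<close>

lemma circuit_size_eq_probes:
  fixes C :: "('n::finite, 'm::finite) depth2_circuit"
  assumes "wf_depth2_circuit C"
  shows "circuit_size C = (\<Sum>i\<in>UNIV. card (update_probes (ds_of_circuit C) i)) +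
    (\<Sum>j\<in>UNIV. card (query_probes (ds_of_circuit C) j))"
  using circuit_size_circuit_of_ds[OF wf_ds_of_circuit[OF assms]]
  by (simp add: circuit_size_def circuit_of_ds_def ds_of_circuit_def)

lemma sum_card_update_probes_le:
  fixes D :: "('n::finite, 'm) linear_ds"
  shows "(\<Sum>i\<in>UNIV. card (update_probes D i)) \<le> CARD('n) * update_time D"
  using sum_bounded_above[of UNIV "\<lambda>i. card (update_probes D i)" "update_time D"]
  by (simp add: update_time_def)

lemma sum_card_query_probes_le:
  fixes D :: "('n, 'm::finite) linear_ds"
  shows "(\<Sum>j\<in>UNIV. card (query_probes D j)) \<le> CARD('m) * query_time D"
  using sum_bounded_above[of UNIV "\<lambda>j. card (query_probes D j)" "query_time D"]
  by (simp add: query_time_def)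

theorem lemma1:
  fixes F :: "('n::finite, 'm::finite) problem"
  shows
    "(\<forall>(D :: ('n, 'm) linear_ds) t\<^sub>q t\<^sub>u.
        wf_linear_ds D \<and> ds_solves D F \<and> query_time D = t\<^sub>q \<and> update_time D = t\<^sub>u \<longrightarrow>
        (\<exists>C :: ('n, 'm) depth2_circuit.
           wf_depth2_circuit C \<and> linear_circuit C \<and> circuit_computes C F \<and>
           circuit_size C \<le> CARD('n) * t\<^sub>u + CARD('m) * t\<^sub>q)) \<and>
     (\<forall>C :: ('n, 'm) depth2_circuit.
        wf_depth2_circuit C \<and> linear_circuit C \<and> circuit_computes C F \<longrightarrow>
        (\<exists>D :: ('n, 'm) linear_ds.
           wf_linear_ds D \<and> ds_solves D F \<and>
           avg_query_time D \<le> real (circuit_size C) / real CARD('m) \<and>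
           avg_update_time D \<le> real (circuit_size C) / real CARD('n)))"
proof (intro conjI allI impI; elim conjE)
  fix D :: "('n, 'm) linear_ds" and t\<^sub>q t\<^sub>u
  assume D: "wf_linear_ds D" "ds_solves D F" "query_time D = t\<^sub>q" "update_time D = t\<^sub>u"
  have "circuit_size (circuit_of_ds D) \<le> CARD('n) * t\<^sub>u + CARD('m) * t\<^sub>q"
    using sum_card_update_probes_le[of D] sum_card_query_probes_le[of D] D(3,4)
    by (simp add: circuit_size_circuit_of_ds[OF D(1)])
  with D show "\<exists>C :: ('n, 'm) depth2_circuit.
      wf_depth2_circuit C \<and> linear_circuit C \<and> circuit_computes C F \<and>
      circuit_size C \<le> CARD('n) * t\<^sub>u + CARD('m) * t\<^sub>q"
    using wf_circuit_of_ds linear_circuit_of_ds circuit_of_ds_computes by blast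
next
  fix C :: "('n, 'm) depth2_circuit"
  assume C: "wf_depth2_circuit C" "linear_circuit C" "circuit_computes C F"
  let ?D = "ds_of_circuit C"
  \<comment> \<open>Each average has as numerator one of the two nonnegative totals that make up the
    size.\<close>
  have "avg_query_time ?D \<le> real (circuit_size C) / real CARD('m)"
    "avg_update_time ?D \<le> real (circuit_size C) / real CARD('n)"
    unfolding avg_query_time_def avg_update_time_def circuit_size_eq_probes[OF C(1)]
    by (auto intro!: divide_right_mono simp del: of_nat_sum)
  with C show "\<exists>D :: ('n, 'm) linear_ds. wf_linear_ds D \<and> ds_solves D F \<and>
      avg_query_time D \<le> real (circuit_size C) / real CARD('m) \<and>
      avg_update_time D \<le> real (circuit_size C) / real CARD('n)"
    using wf_ds_of_circuit ds_of_circuit_solves by blast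
qed

end
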